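(* Let $m,p,k,l,N$ be positive integers, $N_c:=2k(m+p)+l$, and assume $N>N_c$. Let $W_p\in\mathbb{R}^{k(m+p)\times N}$ be a (deterministic) matrix, $\bar L_p\in\mathbb{R}^{kp\times k(m+p)}$ a (deterministic) matrix, $q\in\{0,1\}$, and $\mathcal{C}\in\mathbb{R}^{N\times N_c}$ a random matrix with independent entries $(\mathcal{C})_{ij}\sim\mathcal{N}(0,1/N_c)$. Let $\bar W_p:=(W_pW_p^T)^qW_p\mathcal{C}$, $\zeta:=\bar L_pW_p\in\mathbb{R}^{kp\times N}$ and $\bar\zeta:=\bar L_p\bar W_p\in\mathbb{R}^{kp\times N_c}$. Then almost surely $\mathcal{R}(\bar\zeta)=\mathcal{R}(\zeta)$.
   Context: $\mathcal{R}(\cdot)$ denotes the range (column space). In the paper, $W_p=[U_p^T\ Y_p^T]^T$ is the stacked past input/output block Hankel data matrix, $\zeta$ is the oblique projection of future outputs onto past data along future inputs, which equals $\bar L_pW_p$, and its compressed counterpart is $\bar\zeta=\bar L_p\bar W_p$; $(W_pW_p^T)^0$ is the identity. *)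

theory Defs
  imports "HOL-Analysis.Analysis" "HOL-Probability.Probability"
begin

text \<open>Power of a square matrix; matpow A 0 is the identity.\<close>
fun matpow :: "real^'n^'n \<Rightarrow> nat \<Rightarrow> real^'n^'n" where
  "matpow A 0 = mat 1"
| "matpow A (Suc n) = A ** matpow A n"

text \<open>Range (column space) of a matrix.\<close>
definition col_range :: "real^'c^'r \<Rightarrow> (real^'r) set" where
  "col_range A = span (columns A)"

text \<open>Matrix built from an entry function (a sample of the random matrix).\<close>
definition mat_of_fun :: "('r \<times> 'c \<Rightarrow> real) \<Rightarrow> real^'c^'r" where
  "mat_of_fun f = (\<chi> i j. f (i, j))"

text \<open>Law of a random matrix with i.i.d. N(0, v) entries, on the entry functions.\<close>
definition gauss_matrix_measure :: "real \<Rightarrow> ('r::finite \<times> 'c::finite \<Rightarrow> real) measure" where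
  "gauss_matrix_measure v = PiM UNIV (\<lambda>_. density lborel (normal_density 0 (sqrt v)))"

end

theory Submission
  imports Defs "HOL-Computational_Algebra.Polynomial"
begin

(*
  Put M = L_p (W_p W_p^T)^q W_p, so that the compressed matrix is M C. Since W W^T W and W
  have the same range, R(M) = R(L_p W_p), and R(M C) = R(M) as soon as C^T is injective on
  the row space S = R(M^T), whose dimension is at most kp \<le> N_c. With P the orthogonal
  projector onto S, this injectivity is equivalent to det (P C C^T P + I - P) \<noteq> 0. The
  determinant is a polynomial in the entries of C, and it is not identically zero because
  C^T can be chosen to be an isometry on S. Finally, a polynomial that is not identically
  zero vanishes only on a null set of any product of measures without atoms: by Fubini,
  each section along one coordinate is a univariate polynomial, which for almost every
  value of the other coordinates is nonzero and so has finitely many roots.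
*)

inductive mpoly_fun :: "'a set \<Rightarrow> (('a \<Rightarrow> real) \<Rightarrow> real) \<Rightarrow> bool" for V where
  const: "mpoly_fun V (\<lambda>x. c)"
| coord: "i \<in> V \<Longrightarrow> mpoly_fun V (\<lambda>x. x i)"
| add: "mpoly_fun V f \<Longrightarrow> mpoly_fun V g \<Longrightarrow> mpoly_fun V (\<lambda>x. f x + g x)"
| mult: "mpoly_fun V f \<Longrightarrow> mpoly_fun V g \<Longrightarrow> mpoly_fun V (\<lambda>x. f x * g x)"

lemma mpoly_fun_cong: "mpoly_fun V f \<Longrightarrow> (\<And>i. i \<in> V \<Longrightarrow> x i = y i) \<Longrightarrow> f x = f y"
  by (induction rule: mpoly_fun.induct) auto

lemma mpoly_fun_diff:
  assumes "mpoly_fun V f" "mpoly_fun V g"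
  shows "mpoly_fun V (\<lambda>x. f x - g x)"
proof -
  have "mpoly_fun V (\<lambda>x. f x + (-1) * g x)" by (intro mpoly_fun.intros assms)
  then show ?thesis by simp
qed

lemma mpoly_fun_sum:
  "finite S \<Longrightarrow> (\<And>s. s \<in> S \<Longrightarrow> mpoly_fun V (f s)) \<Longrightarrow> mpoly_fun V (\<lambda>x. \<Sum>s\<in>S. f s x)"
  by (induction rule: finite_induct) (auto intro: mpoly_fun.intros)

lemma mpoly_fun_prod:
  "finite S \<Longrightarrow> (\<And>s. s \<in> S \<Longrightarrow> mpoly_fun V (f s)) \<Longrightarrow> mpoly_fun V (\<lambda>x. \<Prod>s\<in>S. f s x)"
  by (induction rule: finite_induct) (auto intro: mpoly_fun.intros)

lemma mpoly_fun_borel_measurable: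
  assumes "mpoly_fun V f" "V \<subseteq> I" "sets N = sets borel"
  shows "f \<in> borel_measurable (PiM I (\<lambda>_. N))"
  using assms(1)
proof (induction rule: mpoly_fun.induct)
  case (coord i)
  then have "(\<lambda>x. x i) \<in> measurable (PiM I (\<lambda>_. N)) N"
    using assms(2) by (intro measurable_component_singleton) auto
  then show ?case using measurable_cong_sets[OF refl assms(3)] by metis
qed auto

lemma mpoly_fun_insert_univariate:
  assumes "mpoly_fun (insert i J) f"
  shows "\<exists>P. (\<forall>d. mpoly_fun J (\<lambda>x. coeff (P x) d)) \<and> (\<forall>x. f x = poly (P x) (x i))"
  using assms
proof (induction rule: mpoly_fun.induct)
  case (const c)
  show ?case by (rule exI[of _ "\<lambda>x. [:c:]"]) (auto simp: coeff_pCons split: nat.split intro: mpoly_fun.intros)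
next
  case (coord j)
  show ?case
  proof (cases "j = i")
    case True
    show ?thesis by (rule exI[of _ "\<lambda>x. [:0, 1:]"]) (auto simp: True intro: mpoly_fun.intros)
  next
    case False
    then have "mpoly_fun J (\<lambda>x. coeff [:x j:] d)" for d
      using coord by (cases d) (auto intro: mpoly_fun.intros)
    then show ?thesis by (intro exI[of _ "\<lambda>x. [:x j:]"]) auto
  qed
next
  case (add f g)
  then obtain P Q where "\<forall>d. mpoly_fun J (\<lambda>x. coeff (P x) d)" "\<forall>x. f x = poly (P x) (x i)"
     "\<forall>d. mpoly_fun J (\<lambda>x. coeff (Q x) d)" "\<forall>x. g x = poly (Q x) (x i)" by blast
  then show ?case by (intro exI[of _ "\<lambda>x. P x + Q x"]) (auto intro: mpoly_fun.intros)
next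
  case (mult f g)
  then obtain P Q where PQ: "\<forall>d. mpoly_fun J (\<lambda>x. coeff (P x) d)" "\<forall>x. f x = poly (P x) (x i)"
     "\<forall>d. mpoly_fun J (\<lambda>x. coeff (Q x) d)" "\<forall>x. g x = poly (Q x) (x i)" by blast
  have "mpoly_fun J (\<lambda>x. coeff (P x * Q x) d)" for d
    unfolding coeff_mult using PQ(1,3) by (intro mpoly_fun_sum) (auto intro!: mpoly_fun.mult)
  then show ?case using PQ by (intro exI[of _ "\<lambda>x. P x * Q x"]) auto
qed

lemma AE_poly_nonzero:
  fixes p :: "real poly"
  assumes "sets N = sets borel" "\<And>A. finite A \<Longrightarrow> emeasure N A = 0" "p \<noteq> 0"
  shows "AE t in N. poly p t \<noteq> 0"
proof (rule AE_I')
  have "finite {t. poly p t = 0}" using poly_roots_finite[OF assms(3)] .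
  then show "{t. poly p t = 0} \<in> null_sets N"
    using assms(1,2) by (auto simp: null_sets_def finite_imp_closed)
qed auto

lemma (in product_sigma_finite) AE_PiM_insert:
  assumes "finite J" "i \<notin> J"
    and sets: "{x \<in> space (PiM (insert i J) M). \<not> Q x} \<in> sets (PiM (insert i J) M)"
    and ae: "AE y in PiM J M. AE t in M i. Q (y(i := t))"
  shows "AE x in PiM (insert i J) M. Q x"
proof (rule AE_I')
  let ?Z = "{x \<in> space (PiM (insert i J) M). \<not> Q x}"
  have "emeasure (PiM (insert i J) M) ?Z = (\<integral>\<^sup>+x. indicator ?Z x \<partial>PiM (insert i J) M)"
    using sets by simp
  also have "\<dots> = (\<integral>\<^sup>+y. \<integral>\<^sup>+t. indicator ?Z (y(i := t)) \<partial>M i \<partial>PiM J M)"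
    by (rule product_nn_integral_insert[OF assms(1,2)]) (use sets in simp)
  also have "\<dots> = (\<integral>\<^sup>+y. \<integral>\<^sup>+t. 0 \<partial>M i \<partial>PiM J M)"
  proof (rule nn_integral_cong_AE)
    show "AE y in PiM J M. (\<integral>\<^sup>+t. indicator ?Z (y(i := t)) \<partial>M i) = (\<integral>\<^sup>+t. 0 \<partial>M i)"
      using ae by eventually_elim (rule nn_integral_cong_AE, erule eventually_mono, simp)
  qed
  finally show "?Z \<in> null_sets (PiM (insert i J) M)" using sets by auto
qed simp

lemma AE_PiM_mpoly_fun_nonzero:
  fixes N :: "real measure"
  assumes N: "sigma_finite_measure N" "sets N = sets borel" "\<And>A. finite A \<Longrightarrow> emeasure N A = 0"
  shows "finite I \<Longrightarrow> mpoly_fun I f \<Longrightarrow> f a \<noteq> 0 \<Longrightarrow> AE x in PiM I (\<lambda>_. N). f x \<noteq> 0"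
proof (induction I arbitrary: f rule: finite_induct)
  case empty
  then have "f x \<noteq> 0" for x using mpoly_fun_cong[of "{}" f x a] by auto
  then show ?case by simp
next
  case (insert i J)
  interpret product_sigma_finite "\<lambda>_. N" using N(1) by (simp add: product_sigma_finite_def)
  obtain P where P: "\<And>d. mpoly_fun J (\<lambda>x. coeff (P x) d)" "\<And>x. f x = poly (P x) (x i)"
    using mpoly_fun_insert_univariate[OF insert.prems(1)] by blast
  have "P a \<noteq> 0" using insert.prems(2) by (auto simp: P(2))
  then have "lead_coeff (P a) \<noteq> 0" by simp
  have "AE y in PiM J (\<lambda>_. N). coeff (P y) (degree (P a)) \<noteq> 0"
    using insert.IH P(1) \<open>lead_coeff (P a) \<noteq> 0\<close> by blast
  then have ae: "AE y in PiM J (\<lambda>_. N). AE t in N. f (y(i := t)) \<noteq> 0"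
  proof (rule eventually_mono)
    fix y assume "coeff (P y) (degree (P a)) \<noteq> 0"
    then have "P y \<noteq> 0" by auto
    moreover have "P (y(i := t)) = P y" for t
      using insert.hyps(2) by (intro poly_eqI mpoly_fun_cong[OF P(1)]) auto
    ultimately show "AE t in N. f (y(i := t)) \<noteq> 0"
      using AE_poly_nonzero[OF N(2,3), of "P y"] by (simp add: P(2))
  qed
  have "f \<in> borel_measurable (PiM (insert i J) (\<lambda>_. N))"
    using mpoly_fun_borel_measurable[OF insert.prems(1) order_refl N(2)] .
  then have sets: "{x \<in> space (PiM (insert i J) (\<lambda>_. N)). \<not> f x \<noteq> 0} \<in> sets (PiM (insert i J) (\<lambda>_. N))"
    by measurable
  show ?case using AE_PiM_insert[where Q = "\<lambda>x. f x \<noteq> 0", OF insert.hyps sets ae] .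
qed

definition mpoly_mat :: "'a set \<Rightarrow> (('a \<Rightarrow> real) \<Rightarrow> real^'m^'k) \<Rightarrow> bool" where
  "mpoly_mat V A \<longleftrightarrow> (\<forall>i j. mpoly_fun V (\<lambda>x. A x $ i $ j))"

lemma mpoly_mat_const: "mpoly_mat V (\<lambda>x. B)"
  unfolding mpoly_mat_def by (simp add: mpoly_fun.const)

lemma mpoly_mat_mat_of_fun: "mpoly_mat UNIV mat_of_fun"
  unfolding mpoly_mat_def mat_of_fun_def by (simp add: mpoly_fun.coord)

lemma mpoly_mat_transpose: "mpoly_mat V A \<Longrightarrow> mpoly_mat V (\<lambda>x. transpose (A x))"
  unfolding mpoly_mat_def by (simp add: transpose_def)

lemma mpoly_mat_add: "mpoly_mat V A \<Longrightarrow> mpoly_mat V B \<Longrightarrow> mpoly_mat V (\<lambda>x. A x + B x)"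
  unfolding mpoly_mat_def by (simp add: mpoly_fun.add)

lemma mpoly_mat_diff: "mpoly_mat V A \<Longrightarrow> mpoly_mat V B \<Longrightarrow> mpoly_mat V (\<lambda>x. A x - B x)"
  unfolding mpoly_mat_def by (simp add: mpoly_fun_diff)

lemma mpoly_mat_mult: "mpoly_mat V A \<Longrightarrow> mpoly_mat V B \<Longrightarrow> mpoly_mat V (\<lambda>x. A x ** B x)"
  unfolding mpoly_mat_def matrix_matrix_mult_def by (simp add: mpoly_fun_sum mpoly_fun.mult)

lemma mpoly_fun_det: "mpoly_mat V (A :: ('a \<Rightarrow> real) \<Rightarrow> real^'n^'n) \<Longrightarrow> mpoly_fun V (\<lambda>x. det (A x))"
  unfolding mpoly_mat_def det_def
  by (intro mpoly_fun_sum mpoly_fun.mult mpoly_fun.const mpoly_fun_prod) (auto simp: finite_permutations)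

(* Keep transpose A *v x as it is; by default the simplifier turns it into x v* A. *)
declare transpose_matrix_vector [simp del]

lemma subspace_range_matrix_vector_mult: "subspace (range ((*v) (A :: real^'n^'m)))"
  by (simp add: matrix_vector_mul_linear linear_subspace_image)

lemma col_range_eq_range: "col_range A = range ((*v) A)"
proof
  show "col_range A \<subseteq> range ((*v) A)"
    unfolding col_range_def
  proof (rule span_minimal)
    show "columns A \<subseteq> range ((*v) A)" by (auto simp: columns_image_basis)
    show "subspace (range ((*v) A))" by (rule subspace_range_matrix_vector_mult)
  qed
  show "range ((*v) A) \<subseteq> col_range A"
    unfolding col_range_def using matrix_vector_mult_in_columnspace by blast
qed

lemma inner_transpose_matrix_vector: "(transpose A *v x) \<bullet> y = x \<bullet> (A *v (y :: real^'n))"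
  by (simp add: transpose_matrix_vector dot_lmul_matrix)

lemma range_matrix_mult_left_cong:
  assumes "range ((*v) X) = range ((*v) Y)"
  shows "range ((*v) (L ** X)) = range ((*v) (L ** Y))"
proof -
  have "range ((*v) (L ** Z)) = (*v) L ` range ((*v) Z)" for Z
    by (simp add: image_image matrix_vector_mul_assoc)
  then show ?thesis using assms by metis
qed

lemma range_matrix_mult_eq:
  fixes M :: "real^'n^'m" and C :: "real^'c^'n"
  assumes inj: "inj_on ((*v) (transpose C)) (range ((*v) (transpose M)))"
  shows "range ((*v) (M ** C)) = range ((*v) M)"
proof (rule subspace_dim_equal[OF subspace_range_matrix_vector_mult subspace_range_matrix_vector_mult])
  show "range ((*v) (M ** C)) \<subseteq> range ((*v) M)"
    by (auto simp: matrix_vector_mul_assoc[symmetric])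
  have "span (range ((*v) (transpose M))) = range ((*v) (transpose M))"
    using subspace_range_matrix_vector_mult span_eq_iff by blast
  then have "dim ((*v) (transpose C) ` range ((*v) (transpose M))) = dim (range ((*v) (transpose M)))"
    using inj dim_image_eq[OF matrix_vector_mul_linear] by metis
  moreover have "(*v) (transpose C) ` range ((*v) (transpose M)) = range ((*v) (transpose (M ** C)))"
    by (simp add: image_image matrix_vector_mul_assoc matrix_transpose_mul)
  ultimately show "dim (range ((*v) M)) \<le> dim (range ((*v) (M ** C)))"
    by (simp add: rank_dim_range[symmetric] rank_transpose)
qed

lemma range_mult_transpose_mult: "range ((*v) (A ** transpose A ** A)) = range ((*v) (A :: real^'n^'m))"
proof -
  have "s = 0" if s: "s \<in> range ((*v) (transpose A))" "transpose (transpose A ** A) *v s = 0" for s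
  proof -
    obtain y where y: "s = transpose A *v y" using s(1) by blast
    have "(A *v s) \<bullet> (A *v s) = (transpose A *v (A *v s)) \<bullet> s"
      by (simp add: inner_transpose_matrix_vector)
    also have "\<dots> = 0" using s(2) by (simp add: matrix_vector_mul_assoc matrix_transpose_mul)
    finally have "A *v s = 0" by simp
    have "s \<bullet> s = y \<bullet> (A *v s)"
      by (simp add: y inner_transpose_matrix_vector)
    then show "s = 0" using \<open>A *v s = 0\<close> by simp
  qed
  then have "inj_on ((*v) (transpose (transpose A ** A))) (range ((*v) (transpose A)))"
    by (simp add: linear_inj_on_iff_eq_0 matrix_vector_mul_linear subspace_range_matrix_vector_mult)
  then show ?thesis using range_matrix_mult_eq by (metis matrix_mul_assoc)
qed

lemma range_matpow_gram_mult:
  assumes "q \<in> {0, 1}"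
  shows "range ((*v) (matpow (A ** transpose A) q ** A)) = range ((*v) (A :: real^'n^'m))"
  using assms range_mult_transpose_mult[of A] by auto

lemma orthogonal_projector_exists:
  fixes S :: "(real^'n) set"
  assumes "subspace S"
  obtains P :: "real^'n^'n"
    where "transpose P = P" "\<And>x. P *v x \<in> S" "\<And>s. s \<in> S \<Longrightarrow> P *v s = s"
proof -
  obtain B where B: "pairwise orthogonal B" "\<And>x. x \<in> B \<Longrightarrow> norm x = 1" "independent B" "span B = S"
    using orthonormal_basis_subspace[OF assms] by metis
  have "finite B" using B(3) independent_bound by blast
  define P :: "real^'n^'n" where "P = (\<chi> i j. \<Sum>b\<in>B. b$i * b$j)"
  have Pv: "P *v x = (\<Sum>b\<in>B. (b \<bullet> x) *\<^sub>R b)" for x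
  proof -
    have "(P *v x)$i = (\<Sum>b\<in>B. (b \<bullet> x) *\<^sub>R b)$i" for i
    proof -
      have "(P *v x)$i = (\<Sum>j\<in>UNIV. \<Sum>b\<in>B. b$i * b$j * x$j)"
        by (simp add: P_def matrix_vector_mult_def sum_distrib_right)
      also have "\<dots> = (\<Sum>b\<in>B. \<Sum>j\<in>UNIV. b$i * b$j * x$j)" by (rule sum.swap)
      also have "\<dots> = (\<Sum>b\<in>B. (b \<bullet> x) *\<^sub>R b)$i"
        by (simp add: inner_vec_def sum_distrib_left sum_distrib_right mult_ac)
      finally show ?thesis .
    qed
    then show ?thesis by (simp add: vec_eq_iff)
  qed
  have fixes_basis: "P *v b = b" if "b \<in> B" for b
  proof -
    have "P *v b = (b \<bullet> b) *\<^sub>R b + (\<Sum>b'\<in>B - {b}. (b' \<bullet> b) *\<^sub>R b')"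
      unfolding Pv using \<open>finite B\<close> that by (simp add: sum.remove)
    also have "(\<Sum>b'\<in>B - {b}. (b' \<bullet> b) *\<^sub>R b') = 0"
      using B(1) that by (intro sum.neutral) (auto simp: pairwise_def orthogonal_def)
    also have "b \<bullet> b = 1" using B(2)[OF that] by (simp add: norm_eq_1)
    finally show ?thesis by simp
  qed
  show ?thesis
  proof
    show "transpose P = P" by (simp add: P_def transpose_def vec_eq_iff mult.commute)
    show "P *v x \<in> S" for x
      unfolding Pv B(4)[symmetric] by (intro span_sum span_scale span_base)
    show "P *v s = s" if "s \<in> S" for s
      using linear_eq_on_span[OF matrix_vector_mul_linear linear_id, of B P s] fixes_basis that B(4)
      by (simp add: id_def)
  qed
qed

definition proj_gram :: "real^'n^'n \<Rightarrow> real^'c^'n \<Rightarrow> real^'n^'n" where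
  "proj_gram P C = P ** C ** transpose C ** P + (mat 1 - P)"

lemma proj_gram_matrix_vector_mult:
  "proj_gram P C *v x = P *v (C *v (transpose C *v (P *v x))) + (x - P *v x)"
  unfolding proj_gram_def
  by (simp add: matrix_vector_mult_add_rdistrib matrix_vector_mult_diff_rdistrib
      matrix_vector_mul_assoc matrix_mul_assoc)

lemma det_proj_gram_nonzero_iff:
  fixes P :: "real^'n^'n" and C :: "real^'c^'n"
  assumes P: "transpose P = P" "\<And>x. P *v x \<in> S" "\<And>s. s \<in> S \<Longrightarrow> P *v s = s"
    and "subspace S"
  shows "det (proj_gram P C) \<noteq> 0 \<longleftrightarrow> inj_on ((*v) (transpose C)) S"
proof -
  have det_ker: "det A \<noteq> 0 \<longleftrightarrow> (\<forall>x. A *v x = 0 \<longrightarrow> x = 0)" for A :: "real^'n^'n"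
    by (meson invertible_det_nz invertible_left_inverse matrix_left_invertible_ker)
  have inj_iff: "inj_on ((*v) (transpose C)) S \<longleftrightarrow> (\<forall>s\<in>S. transpose C *v s = 0 \<longrightarrow> s = 0)"
    using \<open>subspace S\<close> by (simp add: linear_inj_on_iff_eq_0 matrix_vector_mul_linear)
  have "x = 0" if ker: "proj_gram P C *v x = 0" and inj: "\<forall>s\<in>S. transpose C *v s = 0 \<longrightarrow> s = 0" for x
  proof -
    define u where "u = P *v x"
    define w where "w = transpose C *v u"
    have "u \<in> S" unfolding u_def by (rule P(2))
    have "x \<bullet> u = u \<bullet> u"
      using P(1) P(3)[OF \<open>u \<in> S\<close>] inner_transpose_matrix_vector[of P u x] by (simp add: u_def inner_commute)
    then have "x \<bullet> (x - u) = (x - u) \<bullet> (x - u)"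
      by (simp add: inner_diff_left inner_diff_right inner_commute)
    moreover have "x \<bullet> (P *v (C *v w)) = w \<bullet> w"
      using P(1) by (simp add: inner_transpose_matrix_vector[symmetric] u_def w_def)
    ultimately have "w \<bullet> w + (x - u) \<bullet> (x - u) = x \<bullet> (proj_gram P C *v x)"
      by (simp add: proj_gram_matrix_vector_mult inner_add_right u_def w_def)
    then have "w \<bullet> w + (x - u) \<bullet> (x - u) = 0" using ker by simp
    then have "w \<bullet> w = 0 \<and> (x - u) \<bullet> (x - u) = 0" by (simp add: add_nonneg_eq_0_iff)
    then have "w = 0" "x = u" by auto
    then show "x = 0" using inj \<open>u \<in> S\<close> unfolding w_def by auto
  qed
  moreover have "proj_gram P C *v s = 0" if "s \<in> S" "transpose C *v s = 0" for s
    using that P(3) by (simp add: proj_gram_matrix_vector_mult)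
  ultimately show ?thesis unfolding det_ker inj_iff by blast
qed

lemma transpose_inj_on_matrix_exists:
  fixes S :: "(real^'n) set"
  assumes "subspace S" "dim S \<le> CARD('c)"
  obtains C :: "real^'c^'n" where "inj_on ((*v) (transpose C)) S"
proof -
  have "dim S \<le> dim (UNIV :: (real^'c) set)" using assms(2) by simp
  then obtain f :: "real^'n \<Rightarrow> real^'c" where f: "linear f" "\<And>x. x \<in> S \<Longrightarrow> norm (f x) = norm x"
    by (metis isometry_subset_subspace[OF assms(1) subspace_UNIV])
  have "inj_on f S"
    unfolding linear_inj_on_iff_eq_0[OF f(1) assms(1)] using f(2) by (metis norm_eq_zero)
  then show ?thesis using that[of "transpose (matrix f)"] f(1) by simp
qed

lemma emeasure_density_lborel_finite:
  assumes "f \<in> borel_measurable lborel" "finite A"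
  shows "emeasure (density lborel f) A = 0"
  using absolutely_continuousI_density[OF assms(1)] finite_imp_null_set_lborel[OF assms(2)]
  by (auto simp: absolutely_continuous_def)

lemma AE_gauss_matrix_transpose_inj_on:
  fixes S :: "(real^'n) set"
  assumes "subspace S" "dim S \<le> CARD('c::finite)" "v > 0"
  shows "AE C in (gauss_matrix_measure v :: ('n \<times> 'c \<Rightarrow> real) measure).
           inj_on ((*v) (transpose (mat_of_fun C))) S"
proof -
  obtain P :: "real^'n^'n"
    where P: "transpose P = P" "\<And>x. P *v x \<in> S" "\<And>s. s \<in> S \<Longrightarrow> P *v s = s"
    using orthogonal_projector_exists[OF assms(1)] by blast
  obtain C0 :: "real^'c^'n" where "inj_on ((*v) (transpose C0)) S"
    using transpose_inj_on_matrix_exists[OF assms(1,2)] by blast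
  moreover have "mat_of_fun (\<lambda>(i, j). C0 $ i $ j) = C0" by (simp add: mat_of_fun_def)
  ultimately have nonzero: "det (proj_gram P (mat_of_fun (\<lambda>(i, j). C0 $ i $ j))) \<noteq> 0"
    by (metis det_proj_gram_nonzero_iff[OF P assms(1)])
  have poly: "mpoly_fun UNIV (\<lambda>C. det (proj_gram P (mat_of_fun C :: real^'c^'n)))"
    unfolding proj_gram_def
    by (intro mpoly_fun_det mpoly_mat_add mpoly_mat_diff mpoly_mat_mult mpoly_mat_transpose
        mpoly_mat_mat_of_fun mpoly_mat_const)
  define N where "N = density lborel (normal_density 0 (sqrt v))"
  have N: "sigma_finite_measure N" "sets N = sets borel" "\<And>A. finite A \<Longrightarrow> emeasure N A = 0"
    unfolding N_def using assms(3)
    by (simp_all add: prob_space_normal_density prob_space_imp_sigma_finite emeasure_density_lborel_finite)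
  have "AE C in PiM UNIV (\<lambda>_. N). det (proj_gram P (mat_of_fun C :: real^'c^'n)) \<noteq> 0"
    using AE_PiM_mpoly_fun_nonzero[where N = N and I = UNIV and a = "\<lambda>(i, j). C0 $ i $ j"
        and f = "\<lambda>C. det (proj_gram P (mat_of_fun C))"] N poly nonzero
    by simp
  then show ?thesis
    unfolding gauss_matrix_measure_def N_def
  proof (rule eventually_mono)
    show "inj_on ((*v) (transpose (mat_of_fun C))) S" if "det (proj_gram P (mat_of_fun C)) \<noteq> 0"
      for C :: "'n \<times> 'c \<Rightarrow> real"
      using that det_proj_gram_nonzero_iff[OF P assms(1)] by blast
  qed
qed

theorem lemma7:
  fixes m p k l N :: nat
    and Wp :: "real^'n^'r"
    and Lp :: "real^'r^'o"
    and q :: nat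
  assumes "m > 0" "p > 0" "k > 0" "l > 0" "N > 0"
    and "CARD('r) = k * (m + p)"
    and "CARD('o) = k * p"
    and "CARD('n) = N"
    and "CARD('c) = 2 * k * (m + p) + l"
    and "N > 2 * k * (m + p) + l"
    and "q \<in> {0, 1}"
  shows "AE C in (gauss_matrix_measure (1 / real (2 * k * (m + p) + l)) :: ('n \<times> 'c::finite \<Rightarrow> real) measure).
           col_range (Lp ** (matpow (Wp ** transpose Wp) q ** Wp ** mat_of_fun C))
           = col_range (Lp ** Wp)"
proof -
  define M where "M = Lp ** (matpow (Wp ** transpose Wp) q ** Wp)"
  have "dim (range ((*v) (transpose M))) = rank (transpose M)" by (simp add: rank_dim_range)
  also have "\<dots> \<le> CARD('o)" using rank_bound[of "transpose M"] by simp
  also have "\<dots> \<le> CARD('c)" using assms(7,9) by (simp add: distrib_left mult.assoc)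
  finally have "dim (range ((*v) (transpose M))) \<le> CARD('c)" .
  moreover have "1 / real (2 * k * (m + p) + l) > 0"
    using assms(4) by (simp only: zero_less_divide_1_iff of_nat_0_less_iff)
  ultimately have "AE C in (gauss_matrix_measure (1 / real (2 * k * (m + p) + l)) :: ('n \<times> 'c \<Rightarrow> real) measure).
      inj_on ((*v) (transpose (mat_of_fun C))) (range ((*v) (transpose M)))"
    by (intro AE_gauss_matrix_transpose_inj_on subspace_range_matrix_vector_mult)
  then show ?thesis
  proof (rule eventually_mono)
    fix C :: "'n \<times> 'c \<Rightarrow> real"
    assume "inj_on ((*v) (transpose (mat_of_fun C))) (range ((*v) (transpose M)))"
    then have "range ((*v) (M ** mat_of_fun C)) = range ((*v) M)" by (rule range_matrix_mult_eq)
    also have "\<dots> = range ((*v) (Lp ** Wp))"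
      unfolding M_def using range_matpow_gram_mult[OF assms(11)] by (rule range_matrix_mult_left_cong)
    finally show "col_range (Lp ** (matpow (Wp ** transpose Wp) q ** Wp ** mat_of_fun C))
        = col_range (Lp ** Wp)"
      by (simp add: col_range_eq_range M_def matrix_mul_assoc)
  qed
qed

end
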